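(* Let $k\ge 2$ and $n\ge 1$ be integers, let $G$ be a graph that admits a neighborhood-balanced $k$-coloring, and let $S=\{v_1,\dots,v_r\}\subsetneq V(G)$ be a proper subset of vertices that is dependent. Let $G\langle S\rangle$ be the subgraph of $G$ induced by $S$, let $q_i=\deg_{G\langle S\rangle}(v_i)$ for $1\le i\le r$, let $p=|E(G\langle S\rangle)|$, and put $$L=\operatorname{lcm}\left(\frac{k}{\gcd(q_1,k)},\frac{k}{\gcd(q_2,k)},\dots,\frac{k}{\gcd(q_r,k)}\right),\qquad M=\frac{k^2}{\gcd(p,k^2)}.$$ If the union $nG_S$ of $n$ copies of $G$ over $S$ admits a neighborhood-balanced $k$-coloring, then $n\equiv 1\pmod{\operatorname{lcm}(L,M)}$.
   Context: All graphs are finite, simple and undirected. A neighborhood-balanced $k$-coloring of a graph is a (not necessarily proper) vertex coloring with colors $1,\dots,k$ such that every vertex has the same number of neighbors of each of the $k$ colors. For a nonempty proper subset $S\subsetneq V(G)$, the union of $n$ copies of $G$ over $S$, denoted $nG_S$, is the graph obtained by taking $n$ vertex-disjoint copies of $G$ and identifying, for each $s\in S$, the $n$ copies of $s$ into a single vertex (so the $n$ copies of the subgraph induced by $S$ are identified into one copy of it, without multiple edges). A subset $S$ is dependent if some two vertices of $S$ are adjacent. Convention: $\gcd(0,k)=k$. *)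

theory Defs
  imports "HOL-Number_Theory.Cong"
begin

record 'a ugraph =
  verts :: "'a set"
  edges :: "'a set set"

text \<open>Finite, simple, undirected graphs: edges are two-element sets of vertices, so loops and
  multiple edges cannot occur.\<close>

definition simple_graph :: "'a ugraph \<Rightarrow> bool" where
  "simple_graph G \<longleftrightarrow> finite (verts G) \<and> (\<forall>e\<in>edges G. e \<subseteq> verts G \<and> card e = 2)"

definition nbrs :: "'a ugraph \<Rightarrow> 'a \<Rightarrow> 'a set" where
  "nbrs G v = {u \<in> verts G. {v, u} \<in> edges G}"

definition deg :: "'a ugraph \<Rightarrow> 'a \<Rightarrow> nat" where
  "deg G v = card (nbrs G v)"

definition induced_subgraph :: "'a ugraph \<Rightarrow> 'a set \<Rightarrow> 'a ugraph" where
  "induced_subgraph G S = \<lparr>verts = S, edges = {e \<in> edges G. e \<subseteq> S}\<rparr>"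

definition dependent_set :: "'a ugraph \<Rightarrow> 'a set \<Rightarrow> bool" where
  "dependent_set G S \<longleftrightarrow> (\<exists>u\<in>S. \<exists>v\<in>S. {u, v} \<in> edges G)"

text \<open>The coloring need not be proper, and not every color has to be used
  (isolated vertices impose no condition).\<close>

definition nb_coloring :: "nat \<Rightarrow> 'a ugraph \<Rightarrow> ('a \<Rightarrow> nat) \<Rightarrow> bool" where
  "nb_coloring k G c \<longleftrightarrow>
     (\<forall>v\<in>verts G. c v \<in> {1..k}) \<and>
     (\<forall>v\<in>verts G. \<forall>i\<in>{1..k}. \<forall>j\<in>{1..k}.
        card {u \<in> nbrs G v. c u = i} = card {u \<in> nbrs G v. c u = j})"

definition nb_colorable :: "nat \<Rightarrow> 'a ugraph \<Rightarrow> bool" where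
  "nb_colorable k G \<longleftrightarrow> (\<exists>c. nb_coloring k G c)"

text \<open>The vertex of the union that represents vertex \<open>v\<close> of the \<open>i\<close>-th copy: the copies of a
  vertex of \<open>S\<close> are all identified to \<open>Inl v\<close>, while the copies of the other vertices stay
  distinct.\<close>

definition copy_vertex :: "'a set \<Rightarrow> nat \<Rightarrow> 'a \<Rightarrow> 'a + nat \<times> 'a" where
  "copy_vertex S i v = (if v \<in> S then Inl v else Inr (i, v))"

definition union_copies :: "nat \<Rightarrow> 'a ugraph \<Rightarrow> 'a set \<Rightarrow> ('a + nat \<times> 'a) ugraph" where
  "union_copies n G S =
     \<lparr>verts = (\<Union>i\<in>{1..n}. copy_vertex S i ` verts G),
      edges = (\<Union>i\<in>{1..n}. (\<lambda>e. copy_vertex S i ` e) ` edges G)\<rparr>"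

end

theory Submission
  imports Defs
begin

text \<open>
  A neighborhood-balanced \<open>k\<close>-coloring imposes two divisibility conditions on a graph. Every
  degree is a multiple of \<open>k\<close> (\<open>nb_coloring_dvd_deg\<close>), because the neighbors of a vertex fall
  into \<open>k\<close> color classes of equal size. The number of edges is a multiple of \<open>k\<^sup>2\<close>
  (\<open>nb_coloring_dvd_card_edges\<close>): the number of ordered adjacent pairs colored \<open>(i, j)\<close> does not
  depend on \<open>j\<close> by balance, hence by symmetry not on \<open>i\<close> either, so all \<open>k\<^sup>2\<close> color pairs occur
  equally often; and the pairs colored \<open>(1, 1)\<close> are the two orientations of the edges inside one
  color class, which accounts for the factor 2 between ordered pairs and edges.

  In the union of \<open>n\<close> copies over \<open>S\<close>, a quantity of \<open>G\<close> with value \<open>d\<close>, of which the part \<open>q\<close>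
  lies inside \<open>S\<close>, takes the value \<open>q + n (d - q) = n d - (n - 1) q\<close>. If the modulus \<open>m\<close> divides
  both \<open>d\<close> and this value, it divides \<open>(n - 1) q\<close>, which means that \<open>m / gcd q m\<close> divides \<open>n - 1\<close>
  (\<open>reduced_modulus_dvd\<close>). Degrees, with \<open>m = k\<close>, yield every term of \<open>L\<close>; edge counts, with
  \<open>m = k\<^sup>2\<close>, yield \<open>M\<close>.
\<close>

section \<open>Divisibility in neighborhood-balanced graphs\<close>

lemma simple_graph_finite_edges:
  assumes "simple_graph H" shows "finite (edges H)"
proof (rule finite_subset)
  show "edges H \<subseteq> Pow (verts H)" "finite (Pow (verts H))"
    using assms by (auto simp: simple_graph_def)
qed

lemma simple_graph_finite_nbrs:
  assumes "simple_graph H" shows "finite (nbrs H v)"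
  using assms by (simp add: simple_graph_def nbrs_def)

lemma nb_coloring_range:
  assumes "nb_coloring k H c" and "v \<in> verts H" shows "c v \<in> {1..k}"
  using assms unfolding nb_coloring_def by blast

lemma nb_coloring_balanced:
  assumes "nb_coloring k H c" and "v \<in> verts H" and "i \<in> {1..k}" and "j \<in> {1..k}"
  shows "card {u \<in> nbrs H v. c u = i} = card {u \<in> nbrs H v. c u = j}"
  using assms unfolding nb_coloring_def by blast

lemma nb_coloring_dvd_deg:
  assumes "simple_graph H" and c: "nb_coloring k H c" and v: "v \<in> verts H" and "k \<ge> 1"
  shows "k dvd deg H v"
proof -
  have "nbrs H v = (\<Union>i\<in>{1..k}. {u \<in> nbrs H v. c u = i})"
    using nb_coloring_range[OF c] by (auto simp: nbrs_def)
  then have "deg H v = card (\<Union>i\<in>{1..k}. {u \<in> nbrs H v. c u = i})"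
    by (simp add: deg_def)
  also have "\<dots> = (\<Sum>i\<in>{1..k}. card {u \<in> nbrs H v. c u = i})"
    using simple_graph_finite_nbrs[OF assms(1)] by (intro card_UN_disjoint) auto
  also have "\<dots> = (\<Sum>i\<in>{1..k}. card {u \<in> nbrs H v. c u = 1})"
  proof (rule sum.cong[OF refl])
    fix i assume "i \<in> {1..k}"
    then show "card {u \<in> nbrs H v. c u = i} = card {u \<in> nbrs H v. c u = 1}"
      using \<open>k \<ge> 1\<close> by (intro nb_coloring_balanced[OF c v]) auto
  qed
  finally show ?thesis by simp
qed

lemma card_ordered_pairs_of_edges:
  assumes "finite F" and "\<And>e. e \<in> F \<Longrightarrow> card e = 2"
  shows "card {(u, v). {u, v} \<in> F} = 2 * card F"
proof -
  have two: "finite {(u, v). {u, v} = e} \<and> card {(u, v). {u, v} = e} = 2" if e: "e \<in> F" for e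
  proof -
    obtain a b where "e = {a, b}" "a \<noteq> b"
      using assms(2)[OF e] by (auto simp: card_2_iff)
    then have "{(u, v). {u, v} = e} = {(a, b), (b, a)}" by (auto simp: doubleton_eq_iff)
    with \<open>a \<noteq> b\<close> show ?thesis by simp
  qed
  have "{(u, v). {u, v} \<in> F} = (\<Union>e\<in>F. {(u, v). {u, v} = e})" by auto
  then have "card {(u, v). {u, v} \<in> F} = (\<Sum>e\<in>F. card {(u, v). {u, v} = e})"
    using assms(1) two by (subst card_UN_disjoint[symmetric]) auto
  then show ?thesis using two by simp
qed

text \<open>The numbers \<open>A i j\<close> of ordered adjacent pairs colored \<open>(i, j)\<close> form a symmetric matrix
  whose rows are constant by balance, so all its entries equal \<open>A 1 1\<close>.\<close>

lemma nb_coloring_dvd_card_edges: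
  assumes H: "simple_graph H" and c: "nb_coloring k H c" and "k \<ge> 1"
  shows "k\<^sup>2 dvd card (edges H)"
proof -
  let ?V = "\<lambda>i. {v \<in> verts H. c v = i}"
  define P where "P = (\<lambda>(i, j). SIGMA v:?V i. {u \<in> nbrs H v. c u = j})"
  define A where "A i j = card (P (i, j))" for i j
  have finV: "finite (verts H)" using H by (simp add: simple_graph_def)
  have finP: "finite (P ij)" for ij
    using finV simple_graph_finite_nbrs[OF H] by (cases ij) (auto simp: P_def)
  have row: "A i j = A i j'" if "j \<in> {1..k}" "j' \<in> {1..k}" for i j j'
  proof -
    have "A i j = (\<Sum>v\<in>?V i. card {u \<in> nbrs H v. c u = j})" for j
      unfolding A_def P_def using finV simple_graph_finite_nbrs[OF H]
      by (simp add: card_SigmaI)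
    then show ?thesis
      using that by (auto intro!: sum.cong nb_coloring_balanced[OF c])
  qed
  have sym: "A i j = A j i" for i j
  proof -
    have "P (j, i) = prod.swap ` P (i, j)"
      by (force simp: P_def nbrs_def insert_commute)
    then show ?thesis by (simp add: A_def card_image)
  qed
  have const: "A i j = A 1 1" if "i \<in> {1..k}" "j \<in> {1..k}" for i j
    using row[of j 1 i] row[of i 1 1] sym[of i 1] that \<open>k \<ge> 1\<close> by simp
  have inV: "u \<in> verts H \<and> v \<in> verts H" if "{u, v} \<in> edges H" for u v
    using that H by (auto simp: simple_graph_def)
  have "{(u, v). {u, v} \<in> edges H} = (\<Union>ij\<in>{1..k} \<times> {1..k}. P ij)"
    using inV nb_coloring_range[OF c] by (auto simp: P_def nbrs_def)
  also have "card \<dots> = (\<Sum>ij\<in>{1..k} \<times> {1..k}. card (P ij))"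
    using finP by (intro card_UN_disjoint) (auto simp: P_def)
  also have "\<dots> = (\<Sum>ij\<in>{1..k} \<times> {1..k}. A 1 1)"
  proof (rule sum.cong[OF refl])
    fix ij assume "ij \<in> {1..k} \<times> {1..k}"
    then show "card (P ij) = A 1 1"
      using const[of "fst ij" "snd ij"] A_def[of "fst ij" "snd ij"] by (simp add: mem_Times_iff)
  qed
  also have "\<dots> = k\<^sup>2 * A 1 1"
    by (simp add: power2_eq_square)
  finally have total: "2 * card (edges H) = k\<^sup>2 * A 1 1"
    using card_ordered_pairs_of_edges[OF simple_graph_finite_edges[OF H]] H
    by (simp add: simple_graph_def)
  define F where "F = {e \<in> edges H. \<forall>v\<in>e. c v = 1}"
  have "P (1, 1) = {(u, v). {u, v} \<in> F}"
    using inV by (auto simp: P_def F_def nbrs_def)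
  then have "A 1 1 = 2 * card F"
    unfolding A_def using card_ordered_pairs_of_edges[of F] H simple_graph_finite_edges[OF H]
    by (simp add: F_def simple_graph_def)
  with total have "card (edges H) = k\<^sup>2 * card F" by simp
  then show ?thesis by simp
qed

section \<open>Degrees and edges of a union of copies\<close>

lemma inj_copy_vertex: "inj (copy_vertex S i)"
  by (auto simp: inj_def copy_vertex_def split: if_splits)

lemma simple_graph_union_copies:
  assumes "simple_graph G"
  shows "simple_graph (union_copies n G S)"
proof -
  have "card (copy_vertex S i ` e) = card e" for i e
    by (meson card_image inj_copy_vertex inj_on_subset subset_UNIV)
  then show ?thesis
    using assms unfolding simple_graph_def union_copies_def by fastforce
qed

text \<open>An edge inside \<open>S\<close> has the same image in every copy; the images of any other edge contain
  the index of their copy.\<close>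

lemma copy_edge_inside:
  assumes "e \<subseteq> S" shows "copy_vertex S i ` e = Inl ` e"
  using assms by (auto simp: copy_vertex_def)

lemma copy_edge_eqD:
  assumes eq: "copy_vertex S i ` e = copy_vertex S j ` f" and "\<not> e \<subseteq> S"
  shows "i = j \<and> e = f"
proof -
  obtain x where "x \<in> e" "x \<notin> S" using assms(2) by auto
  then have "Inr (i, x) \<in> copy_vertex S i ` e" by (force simp: copy_vertex_def)
  then have "i = j" unfolding eq by (auto simp: copy_vertex_def split: if_splits)
  with eq show ?thesis using inj_image_eq_iff[OF inj_copy_vertex] by metis
qed

lemma card_edges_union_copies:
  fixes G :: "'a ugraph" and S :: "'a set"
  assumes G: "simple_graph G" and "n \<ge> 1"
  defines "p \<equiv> card (edges (induced_subgraph G S))"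
  shows "card (edges (union_copies n G S)) = p + n * (card (edges G) - p)"
proof -
  let ?I = "{e \<in> edges G. e \<subseteq> S}" and ?O = "{e \<in> edges G. \<not> e \<subseteq> S}"
  let ?h = "\<lambda>(i, e). copy_vertex S i ` e"
  have fin: "finite (edges G)" by (rule simple_graph_finite_edges[OF G])
  have p: "p = card ?I" by (simp add: p_def induced_subgraph_def)
  have "edges (union_copies n G S) = ((`) Inl ` ?I) \<union> ?h ` ({1..n} \<times> ?O)" (is "_ = ?A \<union> ?B")
  proof (intro equalityI subsetI)
    fix x assume "x \<in> edges (union_copies n G S)"
    then obtain i e where "i \<in> {1..n}" "e \<in> edges G" "x = copy_vertex S i ` e"
      by (auto simp: union_copies_def)
    then show "x \<in> ?A \<union> ?B"
      by (cases "e \<subseteq> S") (auto simp: copy_edge_inside)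
  next
    fix x assume "x \<in> ?A \<union> ?B"
    then show "x \<in> edges (union_copies n G S)"
    proof
      assume "x \<in> ?A"
      then obtain e where "e \<in> edges G" "e \<subseteq> S" "x = copy_vertex S 1 ` e"
        using copy_edge_inside[of _ S 1] by auto
      then show ?thesis using \<open>n \<ge> 1\<close> by (force simp: union_copies_def)
    next
      assume "x \<in> ?B"
      then show ?thesis by (auto simp: union_copies_def)
    qed
  qed
  moreover have "card (?A \<union> ?B) = card ?A + card ?B"
  proof (rule card_Un_disjoint)
    show "finite ?A" "finite ?B" using fin by auto
    have "e \<subseteq> S" if "Inl ` f = copy_vertex S i ` e" for e f :: "'a set" and i
    proof
      fix x assume "x \<in> e"
      then have "copy_vertex S i x \<in> Inl ` f" unfolding that by auto
      then show "x \<in> S" by (auto simp: copy_vertex_def split: if_splits)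
    qed
    then show "?A \<inter> ?B = {}" by auto
  qed
  moreover have "card ?A = p"
    unfolding p by (intro card_image inj_onI) (simp add: inj_image_eq_iff)
  moreover have "inj_on ?h ({1..n} \<times> ?O)"
    by (auto simp: inj_on_def dest: copy_edge_eqD)
  then have "card ?B = n * card ?O" by (simp add: card_image card_cartesian_product)
  moreover have "?O = edges G - ?I" by auto
  then have "card ?O = card (edges G) - p" unfolding p using fin by (simp add: card_Diff_subset)
  ultimately show ?thesis by simp
qed

lemma deg_union_copies:
  assumes G: "simple_graph G" and "n \<ge> 1" and S: "S \<subseteq> verts G" and v: "v \<in> S"
  defines "q \<equiv> deg (induced_subgraph G S) v"
  shows "deg (union_copies n G S) (Inl v) = q + n * (deg G v - q)"
proof -
  let ?I = "nbrs G v \<inter> S" and ?O = "nbrs G v - S"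
  have fin: "finite (nbrs G v)" by (rule simple_graph_finite_nbrs[OF G])
  have q: "q = card ?I"
    unfolding q_def deg_def using S v
    by (intro arg_cong[where f = card]) (auto simp: nbrs_def induced_subgraph_def)
  have nbr_iff: "w \<in> nbrs (union_copies n G S) (Inl v) \<longleftrightarrow>
      (\<exists>i\<in>{1..n}. \<exists>u\<in>nbrs G v. w = copy_vertex S i u)" (is "?l \<longleftrightarrow> ?r") for w
  proof
    assume ?l
    then obtain i e where i: "i \<in> {1..n}" "e \<in> edges G" and e: "{Inl v, w} = copy_vertex S i ` e"
      by (auto simp: nbrs_def union_copies_def)
    \<comment> \<open>The edge comes from a single copy, so both of its ends have preimages in that copy.\<close>
    obtain u where u: "u \<in> e" "w = copy_vertex S i u"
      using e by (metis imageE insertCI)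
    have "copy_vertex S i ` {v, u} = copy_vertex S i ` e"
      using v unfolding e[symmetric] u(2) by (simp add: copy_vertex_def)
    then have "{v, u} = e" using inj_image_eq_iff[OF inj_copy_vertex] by metis
    then have "u \<in> nbrs G v" using i G u by (auto simp: nbrs_def simple_graph_def)
    then show ?r using i u by auto
  next
    assume ?r
    then obtain i u where iu: "i \<in> {1..n}" "u \<in> verts G" "{v, u} \<in> edges G" "w = copy_vertex S i u"
      by (auto simp: nbrs_def)
    have "{Inl v, w} = copy_vertex S i ` {v, u}" using iu v by (simp add: copy_vertex_def)
    then have "{Inl v, w} \<in> (`) (copy_vertex S i) ` edges G"
      using iu(3) by (rule image_eqI)
    then have "{Inl v, w} \<in> edges (union_copies n G S)"
      using iu(1) unfolding union_copies_def by fastforce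
    then show ?l using iu by (auto simp: nbrs_def union_copies_def)
  qed
  have "nbrs (union_copies n G S) (Inl v) = Inl ` ?I \<union> Inr ` ({1..n} \<times> ?O)" (is "_ = ?A \<union> ?B")
  proof (intro set_eqI iffI)
    fix w assume "w \<in> nbrs (union_copies n G S) (Inl v)"
    then show "w \<in> ?A \<union> ?B" unfolding nbr_iff by (auto simp: copy_vertex_def)
  next
    fix w assume "w \<in> ?A \<union> ?B"
    then show "w \<in> nbrs (union_copies n G S) (Inl v)"
      unfolding nbr_iff copy_vertex_def using \<open>n \<ge> 1\<close> by force
  qed
  moreover have "card (?A \<union> ?B) = card ?A + card ?B"
    using fin by (intro card_Un_disjoint) auto
  moreover have "card ?A = q" by (simp add: q card_image)
  moreover have "card ?B = n * card ?O" by (simp add: card_image card_cartesian_product)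
  moreover have "card ?O = deg G v - q" using fin by (simp add: q deg_def card_Diff_subset_Int)
  ultimately show ?thesis by (simp add: deg_def)
qed

section \<open>The congruence\<close>

lemma reduced_modulus_dvd:
  fixes m d q n :: nat
  assumes "m > 0" and "m dvd d" and "q \<le> d" and "n \<ge> 1" and "m dvd q + n * (d - q)"
  shows "m div gcd q m dvd n - 1"
proof -
  obtain r where r: "d = q + r" using \<open>q \<le> d\<close> le_Suc_ex by blast
  obtain n' where n': "n = Suc n'" using \<open>n \<ge> 1\<close> by (cases n) auto
  have "q + n * (d - q) + (n - 1) * q = n * d"
    by (simp add: r n' algebra_simps)
  then have "m dvd (n - 1) * q"
    using assms(2,5) by (metis dvd_add_right_iff dvd_mult)
  then have "m div gcd q m dvd (n - 1) * q div gcd q m"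
    by (meson div_dvd_div dvd_mult gcd_dvd1 gcd_dvd2)
  also have "(n - 1) * q div gcd q m = (n - 1) * (q div gcd q m)"
    by (simp add: div_mult_swap)
  finally show ?thesis
    using div_gcd_coprime[of q m] \<open>m > 0\<close> by (simp add: coprime_dvd_mult_left_iff coprime_commute)
qed

theorem theorem3p9:
  fixes G :: "'a ugraph" and S :: "'a set" and q :: "'a \<Rightarrow> nat" and k n p L M :: nat
  assumes "k \<ge> 2" and "n \<ge> 1"
    and "simple_graph G" and "nb_colorable k G"
    and "S \<subset> verts G" and "dependent_set G S"
    and "\<And>v. v \<in> S \<Longrightarrow> q v = deg (induced_subgraph G S) v"
    and "p = card (edges (induced_subgraph G S))"
    and "L = (LCM v\<in>S. k div gcd (q v) k)"
    and "M = k\<^sup>2 div gcd p (k\<^sup>2)"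
    and "nb_colorable k (union_copies n G S)"
  shows "[n = 1] (mod (lcm L M))"
proof -
  let ?U = "union_copies n G S"
  have k: "k \<ge> 1" "k > 0" "k\<^sup>2 > 0" using \<open>k \<ge> 2\<close> by auto
  have S: "S \<subseteq> verts G" using assms(5) by auto
  have U: "simple_graph ?U" by (rule simple_graph_union_copies[OF assms(3)])
  obtain c where c: "nb_coloring k G c" using assms(4) by (auto simp: nb_colorable_def)
  obtain c' where c': "nb_coloring k ?U c'" using assms(11) by (auto simp: nb_colorable_def)
  have "k div gcd (q v) k dvd n - 1" if v: "v \<in> S" for v
  proof (rule reduced_modulus_dvd)
    show "k dvd deg G v"
      using nb_coloring_dvd_deg[OF assms(3) c _ k(1)] v S by auto
    have "Inl v \<in> verts ?U"
      using v S \<open>n \<ge> 1\<close> by (force simp: union_copies_def copy_vertex_def)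
    then show "k dvd q v + n * (deg G v - q v)"
      using nb_coloring_dvd_deg[OF U c' _ k(1), of "Inl v"]
        deg_union_copies[OF assms(3,2) S v] assms(7)[OF v] by simp
    show "q v \<le> deg G v"
      unfolding assms(7)[OF v] deg_def using S
      by (intro card_mono simple_graph_finite_nbrs[OF assms(3)])
        (auto simp: nbrs_def induced_subgraph_def)
  qed (use k \<open>n \<ge> 1\<close> in auto)
  then have "L dvd n - 1" unfolding assms(9) by (intro Lcm_least) auto
  moreover have "M dvd n - 1"
    unfolding assms(10)
  proof (rule reduced_modulus_dvd)
    show "k\<^sup>2 dvd card (edges G)" by (rule nb_coloring_dvd_card_edges[OF assms(3) c k(1)])
    show "k\<^sup>2 dvd p + n * (card (edges G) - p)"
      using nb_coloring_dvd_card_edges[OF U c' k(1)]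
        card_edges_union_copies[OF assms(3,2), of S] assms(8) by simp
    show "p \<le> card (edges G)"
      unfolding assms(8)
      by (intro card_mono simple_graph_finite_edges[OF assms(3)])
        (auto simp: induced_subgraph_def)
  qed (use k \<open>n \<ge> 1\<close> in auto)
  ultimately have "lcm L M dvd n - 1" by simp
  then have "[1 = n] (mod lcm L M)" using cong_altdef_nat[of 1 n] \<open>n \<ge> 1\<close> by (simp add: cong_sym_eq)
  then show ?thesis by (rule cong_sym)
qed

end
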